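(* Let $P\neq\{0\}$ be a finite poset with least element $0$ such that $[P]$ is a Boolean lattice. Let $q_1,\dots,q_n$ be all the (distinct) atoms of $P$, and for each $i$ let $P_i=\{x\in P : q_i\le x \text{ and } q_j\not\le x \text{ for all } j\ne i\}$. Then: (A) $G(P)$ is chordal if and only if one of the following holds: (1) $P$ has exactly one atom; (2) $P$ has exactly two atoms and $|P_i|=1$ for some $i\in\{1,2\}$; (3) $P$ has exactly three atoms and $|P_i|=1$ for all $i\in\{1,2,3\}$. (B) The complement $G^c(P)$ is chordal if and only if the number of atoms of $P$ is at most $3$. (C) $G(P)$ is perfect if and only if $P$ has at most $4$ atoms.
   Context: For a poset $P$ with least element $0$ and $A\subseteq P$, $A^\ell=\{b\in P: b\le a\ \forall a\in A\}$. For $a\in P$, $a^\perp=\{b\in P:\{a,b\}^\ell=\{0\}\}$. An atom is a minimal element of $P\setminus\{0\}$. Define $a\sim b$ iff $a^\perp=b^\perp$; $[P]$ denotes the set of equivalence classes $[a]$, partially ordered by $[a]\le[b]$ iff $b^\perp\subseteq a^\perp$. The set of zero-divisors is $Z(P)=\{a\in P:\exists\, b\in P\setminus\{0\},\ \{a,b\}^\ell=\{0\}\}$. The zero-divisor graph $G(P)$ is the simple graph with vertex set $Z(P)\setminus\{0\}$ in which $a,b$ are adjacent iff $\{a,b\}^\ell=\{0\}$; $G^c(P)$ is its graph complement. A graph is chordal if it has no induced cycle of length at least $4$. A finite graph is perfect if every induced subgraph has chromatic number equal to its clique number. The null graph (no vertices) is regarded as chordal and perfect. *)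

theory Defs
  imports
    "HOL-Algebra.Lattice"
    "Graph_Theory.Digraph_Component"
begin

section \<open>Boolean lattices\<close>

locale boolean_lattice = bounded_lattice +
  assumes distributive:
      "\<lbrakk>x \<in> carrier L; y \<in> carrier L; z \<in> carrier L\<rbrakk>
        \<Longrightarrow> x \<sqinter> (y \<squnion> z) = (x \<sqinter> y) \<squnion> (x \<sqinter> z)"
    and complemented:
      "x \<in> carrier L \<Longrightarrow> \<exists>y\<in>carrier L. x \<sqinter> y = \<bottom> \<and> x \<squnion> y = \<top>"

section \<open>Annihilators in a poset with least element\<close>

text \<open>
  Throughout, \<open>P\<close> is meant to be a partial order with a least element, written
  \<open>\<bottom>\<^bsub>P\<^esub>\<close>. The set of lower bounds of \<open>A\<close> within \<open>carrier P\<close> is \<open>Lower P A\<close>.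
\<close>

definition poset_atoms :: "('a, 'm) gorder_scheme \<Rightarrow> 'a set" where
  "poset_atoms P =
     {q \<in> carrier P - {\<bottom>\<^bsub>P\<^esub>}. \<forall>x \<in> carrier P - {\<bottom>\<^bsub>P\<^esub>}. x \<sqsubseteq>\<^bsub>P\<^esub> q \<longrightarrow> x = q}"

definition perp :: "('a, 'm) gorder_scheme \<Rightarrow> 'a \<Rightarrow> 'a set" where
  "perp P a = {b \<in> carrier P. Lower P {a, b} = {\<bottom>\<^bsub>P\<^esub>}}"

definition perp_rel :: "('a, 'm) gorder_scheme \<Rightarrow> 'a rel" where
  "perp_rel P = {(a, b). a \<in> carrier P \<and> b \<in> carrier P \<and> perp P a = perp P b}"

text \<open>
  The poset \<open>[P]\<close> of classes. The order is stated on representatives; by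
  \<open>perp_quotient_le_iff\<close> below, their choice is irrelevant.
\<close>

definition perp_quotient :: "('a, 'm) gorder_scheme \<Rightarrow> 'a set gorder" where
  "perp_quotient P =
     \<lparr> carrier = carrier P // perp_rel P,
       eq = (=),
       le = (\<lambda>A B. \<exists>a\<in>A. \<exists>b\<in>B. perp P b \<subseteq> perp P a) \<rparr>"

lemma equiv_perp_rel: "equiv (carrier P) (perp_rel P)"
  by (auto simp: equiv_def refl_on_def sym_def trans_def perp_rel_def)

lemma perp_quotient_le_iff:
  assumes "a \<in> carrier P" "b \<in> carrier P"
  shows "perp_rel P `` {a} \<sqsubseteq>\<^bsub>perp_quotient P\<^esub> perp_rel P `` {b} \<longleftrightarrow> perp P b \<subseteq> perp P a"
  using assms by (auto simp: perp_quotient_def perp_rel_def)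

section \<open>Graphs\<close>

text \<open>
  Simple graphs are loop-free symmetric digraphs without parallel arcs, that is, instances of
  the locale \<^locale>\<open>graph\<close>; the notions below are intended for these (finite, possibly null)
  graphs.
\<close>

definition cycle_graph :: "('a, 'b) pre_digraph \<Rightarrow> bool" where
  "cycle_graph G \<longleftrightarrow>
     (\<exists>vs. distinct vs \<and> length vs \<ge> 3 \<and> verts G = set vs \<and>
        arcs_ends G =
          {(vs ! i, vs ! j) | i j. i < length vs \<and> j < length vs \<and>
             (j = Suc i mod length vs \<or> i = Suc j mod length vs)})"

definition chordal :: "('a, 'b) pre_digraph \<Rightarrow> bool" where
  "chordal G \<longleftrightarrow> \<not> (\<exists>H. induced_subgraph H G \<and> cycle_graph H \<and> card (verts H) \<ge> 4)"

definition proper_coloring :: "('a, 'b) pre_digraph \<Rightarrow> nat \<Rightarrow> ('a \<Rightarrow> nat) \<Rightarrow> bool" where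
  "proper_coloring G k c \<longleftrightarrow>
     (\<forall>v\<in>verts G. c v < k) \<and> (\<forall>(u, v)\<in>arcs_ends G. c u \<noteq> c v)"

definition chromatic_number :: "('a, 'b) pre_digraph \<Rightarrow> nat" where
  "chromatic_number G = (LEAST k. \<exists>c. proper_coloring G k c)"

definition clique :: "('a, 'b) pre_digraph \<Rightarrow> 'a set \<Rightarrow> bool" where
  "clique G K \<longleftrightarrow> K \<subseteq> verts G \<and> (\<forall>u\<in>K. \<forall>v\<in>K. u \<noteq> v \<longrightarrow> (u, v) \<in> arcs_ends G)"

definition clique_number :: "('a, 'b) pre_digraph \<Rightarrow> nat" where
  "clique_number G = Max {card K | K. clique G K}"

definition perfect :: "('a, 'b) pre_digraph \<Rightarrow> bool" where
  "perfect G \<longleftrightarrow> (\<forall>H. induced_subgraph H G \<longrightarrow> chromatic_number H = clique_number H)"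

definition graph_complement :: "'a pair_pre_digraph \<Rightarrow> 'a pair_pre_digraph" where
  "graph_complement G =
     \<lparr> pverts = pverts G,
       parcs = {(u, v). u \<in> pverts G \<and> v \<in> pverts G \<and> u \<noteq> v \<and> (u, v) \<notin> parcs G} \<rparr>"

section \<open>The zero-divisor graph\<close>

definition zero_divisors :: "('a, 'm) gorder_scheme \<Rightarrow> 'a set" where
  "zero_divisors P =
     {a \<in> carrier P. \<exists>b \<in> carrier P - {\<bottom>\<^bsub>P\<^esub>}. Lower P {a, b} = {\<bottom>\<^bsub>P\<^esub>}}"

definition zero_divisor_graph :: "('a, 'm) gorder_scheme \<Rightarrow> 'a pair_pre_digraph" where
  "zero_divisor_graph P =
     (let V = zero_divisors P - {\<bottom>\<^bsub>P\<^esub>}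
      in \<lparr> pverts = V,
           parcs = {(a, b). a \<in> V \<and> b \<in> V \<and> Lower P {a, b} = {\<bottom>\<^bsub>P\<^esub>}} \<rparr>)"

lemma pair_graph_zero_divisor_graph:
  assumes "partial_order P" "finite (carrier P)"
  shows "pair_graph (zero_divisor_graph P)"
proof -
  interpret partial_order P by fact
  let ?G = "zero_divisor_graph P"
  have V: "pverts ?G \<subseteq> carrier P"
    by (auto simp: zero_divisor_graph_def zero_divisors_def)
  have A: "parcs ?G \<subseteq> pverts ?G \<times> pverts ?G"
    by (auto simp: zero_divisor_graph_def Let_def)
  have fin: "finite (pverts ?G)"
    using V assms(2) by (rule finite_subset)
  have loop: "fst e \<noteq> snd e" if "e \<in> parcs ?G" for e
  proof
    assume eq: "fst e = snd e"
    define a where "a = fst e"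
    from that eq have "(a, a) \<in> parcs ?G"
      by (cases e) (simp add: a_def)
    then have "a \<noteq> \<bottom>\<^bsub>P\<^esub>" "a \<in> carrier P" "Lower P {a, a} = {\<bottom>\<^bsub>P\<^esub>}"
      by (auto simp: zero_divisor_graph_def zero_divisors_def Let_def)
    moreover have "a \<in> Lower P {a, a}"
      using \<open>a \<in> carrier P\<close> by (auto simp: Lower_def)
    ultimately show False by auto
  qed
  have symm: "sym (parcs ?G)"
    by (auto simp: sym_def zero_divisor_graph_def Let_def insert_commute)
  show ?thesis
    using A fin loop symm finite_subset[OF A]
    by unfold_locales (auto simp: symmetric_def)
qed

lemma pair_graph_graph_complement:
  assumes "pair_graph G"
  shows "pair_graph (graph_complement G)"
proof -
  interpret pair_graph G by fact
  have "finite (parcs (graph_complement G))"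
    by (rule finite_subset[of _ "pverts G \<times> pverts G"])
       (auto simp: graph_complement_def pair_finite_verts)
  moreover have "sym (parcs G)"
    using pair_sym_arcs by (simp add: symmetric_def)
  ultimately show ?thesis
    by unfold_locales
       (auto simp: graph_complement_def pair_finite_verts symmetric_def sym_def)
qed

end

theory Submission
  imports Defs
begin

text \<open>
  Label every \<open>x\<close> with the set \<open>atoms_below P x\<close> of atoms below it. Two elements have only
  \<open>\<bottom>\<close> as a common lower bound exactly when their labels are disjoint, because every nonzero
  element of a finite poset lies above an atom. So \<open>G(P)\<close> is the disjointness graph of the
  labels, its vertices being the elements whose label is neither empty nor the set \<open>U\<close> of all
  atoms (\<open>zero_divisor_graph_eq\<close>). Inclusion of annihilators is reverse inclusion of labels
  (\<open>perp_subset_iff\<close>), hence \<open>[P]\<close> is the set of labels ordered by inclusion. Distributivity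
  of \<open>[P]\<close> forces the join of the classes of two atoms \<open>p\<close>, \<open>r\<close> to have the label
  \<open>{p, r}\<close> and no more (\<open>doubleton_atoms_below\<close>), so every one- or two-element set of atoms
  is a label. The rest is about disjoint subsets of a small set.

  Chordality of \<open>G(P)\<close> (\<open>chordal_iff\<close>). Labels \<open>{p}, {r}, {p, s}, {r, t}\<close> form an induced
  4-cycle when there are four atoms. With three atoms, one repeated singleton label \<open>{p}\<close> gives
  the 4-cycle \<open>{p}, {r}, {p}, {r, s}\<close>; with two atoms, two repeated ones give \<open>{p}, {r}, {p}, {r}\<close>.
  Otherwise the labels inside a chordless cycle turn out to be singletons, so vertices at distance two,
  whose labels meet, carry the same label, and the classes are too small for that.

  Chordality of the complement (\<open>chordal_complement_iff\<close>). Four atoms give the 4-cycle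
  \<open>{p, r}, {r, s}, {s, t}, {t, p}\<close>. Conversely, in a chordless cycle for the relation of
  meeting, each label meets two disjoint labels and so has at least two atoms; two vertices at
  distance two therefore use up four atoms.

  Perfection (\<open>perfect_iff\<close>). Five atoms give a 5-cycle of two-element labels, as in the Petersen
  graph. For at most four atoms, an optimal colouring of an induced subgraph is explicit: one colour
  for each singleton label \<open>{p}\<close> that occurs, used for labels containing \<open>p\<close>. The labels left over
  have at least two elements; if two of them are disjoint, split them by whether they contain a fixed
  atom \<open>u\<close>: those avoiding \<open>u\<close> have two of the at most three other atoms, so they meet pairwise.
  The singleton labels together with at most two leftover labels form a clique with as many vertices
  as there are colours.
\<close>

section \<open>Chordality and perfection of finite simple graphs\<close>

lemma induced_subgraph_with_projD:
  assumes "induced_subgraph H (with_proj G)"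
  shows "verts H \<subseteq> pverts G" "arcs_ends H = parcs G \<inter> verts H \<times> verts H"
proof -
  from assms have sub: "subgraph H G"
    and arcs: "arcs H = {e \<in> parcs G. fst e \<in> verts H \<and> snd e \<in> verts H}"
    and ends: "tail H = fst" "head H = snd"
    by (auto simp: induced_subgraph_def subgraph_def compatible_def)
  from sub show "verts H \<subseteq> pverts G" by (auto simp: subgraph_def)
  show "arcs_ends H = parcs G \<inter> verts H \<times> verts H"
    by (force simp: arcs_ends_conv ends arcs)
qed

lemma induced_subgraph_restrict_with_proj:
  assumes "pair_graph G" "W \<subseteq> pverts G"
  shows "induced_subgraph (with_proj G \<restriction> W) (with_proj G)"
proof -
  interpret pair_graph G by fact
  show ?thesis using assms(2) by (intro induced_induce) auto
qed

text \<open>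
  A chordless cycle of length at least 4 contains such a walk: take five consecutive vertices. In a
  4-cycle \<open>w\<close> and \<open>d\<close> coincide, which is why nothing relates them. Three consecutive
  non-adjacencies at distance two are all that the applications below need, so cycle indices
  appear here only.
\<close>
lemma chordal_if_no_induced_walk:
  assumes no_path: "\<And>w a b c d. \<lbrakk>(w, a) \<in> parcs G; (a, b) \<in> parcs G; (b, c) \<in> parcs G; (c, d) \<in> parcs G;
      (w, b) \<notin> parcs G; (a, c) \<notin> parcs G; (b, d) \<notin> parcs G; w \<noteq> b; a \<noteq> c; b \<noteq> d\<rbrakk> \<Longrightarrow> False"
  shows "chordal (with_proj G)"
proof (unfold chordal_def, rule notI, elim exE conjE)
  fix H :: "('a, 'a \<times> 'a) pre_digraph"
  assume H: "induced_subgraph H (with_proj G)" "cycle_graph H" "4 \<le> card (verts H)"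
  from H(2) obtain vs where vs: "distinct vs" "verts H = set vs"
    and ends: "arcs_ends H = {(vs ! i, vs ! j) | i j. i < length vs \<and> j < length vs \<and>
             (j = Suc i mod length vs \<or> i = Suc j mod length vs)}"
    by (auto simp: cycle_graph_def)
  define k where "k = length vs"
  have k: "k \<ge> 4" using H(3) vs by (simp add: k_def distinct_card)
  have arc: "(vs ! i, vs ! j) \<in> parcs G \<longleftrightarrow> j = Suc i mod k \<or> i = Suc j mod k"
    if "i < k" "j < k" for i j
  proof -
    have "(vs ! i, vs ! j) \<in> parcs G \<longleftrightarrow> (vs ! i, vs ! j) \<in> arcs_ends H"
      using induced_subgraph_with_projD(2)[OF H(1)] that vs by (auto simp: k_def)
    also have "\<dots> \<longleftrightarrow> j = Suc i mod k \<or> i = Suc j mod k"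
      using that vs(1) by (auto simp: ends k_def nth_eq_iff_index_eq)
    finally show ?thesis .
  qed
  have neq: "vs ! i \<noteq> vs ! j" if "i < k" "j < k" "i \<noteq> j" for i j
    using that vs(1) by (auto simp: k_def nth_eq_iff_index_eq)
  have last: "Suc (k - Suc 0) mod k = 0" using k by simp
  have four: "4 mod k \<noteq> Suc 0" using k by (cases "k = 4") auto
  show False
    by (rule no_path[of "vs ! (k - 1)" "vs ! 0" "vs ! 1" "vs ! 2" "vs ! 3"])
       (use k last four in \<open>auto simp: arc neq\<close>)
qed

lemma not_chordal_if_induced_C4:
  assumes G: "pair_graph G"
    and V: "{a, b, c, d} \<subseteq> pverts G"
    and arcs: "(a, b) \<in> parcs G" "(b, c) \<in> parcs G" "(c, d) \<in> parcs G" "(d, a) \<in> parcs G"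
    and non_arcs: "(a, c) \<notin> parcs G" "(b, d) \<notin> parcs G"
    and neq: "a \<noteq> c" "b \<noteq> d"
  shows "\<not> chordal (with_proj G)"
proof -
  interpret pair_graph G by fact
  let ?H = "with_proj G \<restriction> {a, b, c, d}"
  note ind = induced_subgraph_restrict_with_proj[OF G V]
  have symm: "(y, x) \<in> parcs G" if "(x, y) \<in> parcs G" for x y
    using that pair_sym_arcs by (auto simp: symmetric_def sym_def)
  have irrefl: "(x, x) \<notin> parcs G" for x
    using pair_no_loops by (metis fst_conv snd_conv)
  have dist: "distinct [a, b, c, d]" using arcs neq irrefl by auto
  have "cycle_graph ?H"
  proof -
    \<comment> \<open>Index pairs and arcs are listed in the same order, so that the lists agree syntactically.\<close>
    let ?I = "{(i, j). i < 4 \<and> j < 4 \<and> (j = Suc i mod 4 \<or> i = Suc j mod 4)}"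
    have less_4: "i < 4 \<longleftrightarrow> i \<in> {0, 1, 2, 3}" for i :: nat by auto
    have I: "?I = {(0, 1), (0, 3), (1, 0), (1, 2), (2, 1), (2, 3), (3, 0), (3, 2)}"
      unfolding less_4 by auto
    have "{([a, b, c, d] ! i, [a, b, c, d] ! j) | i j. i < 4 \<and> j < 4 \<and>
        (j = Suc i mod 4 \<or> i = Suc j mod 4)} = (\<lambda>(i, j). ([a, b, c, d] ! i, [a, b, c, d] ! j)) ` ?I"
      by auto
    also have "\<dots> = {(a, b), (a, d), (b, a), (b, c), (c, b), (c, d), (d, a), (d, c)}"
      unfolding I by simp
    also have "\<dots> = parcs G \<inter> {a, b, c, d} \<times> {a, b, c, d}"
    proof -
      have "{a, b, c, d} \<times> {a, b, c, d} =
          {(a, a), (a, b), (a, c), (a, d), (b, a), (b, b), (b, c), (b, d),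
           (c, a), (c, b), (c, c), (c, d), (d, a), (d, b), (d, c), (d, d)}"
        by blast
      moreover have "(c, a) \<notin> parcs G" "(d, b) \<notin> parcs G" using non_arcs symm by blast+
      ultimately show ?thesis
        using arcs arcs[THEN symm] non_arcs irrefl by simp
    qed
    also have "\<dots> = arcs_ends ?H"
      using induced_subgraph_with_projD(2)[OF ind] by simp
    finally have ends: "arcs_ends ?H = {([a, b, c, d] ! i, [a, b, c, d] ! j) | i j. i < 4 \<and> j < 4 \<and>
        (j = Suc i mod 4 \<or> i = Suc j mod 4)}" by (rule sym)
    have len: "length [a, b, c, d] = 4" by simp
    show ?thesis
      unfolding cycle_graph_def
    proof (intro exI[of _ "[a, b, c, d]"] conjI)
      show "arcs_ends ?H = {([a, b, c, d] ! i, [a, b, c, d] ! j) | i j.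
          i < length [a, b, c, d] \<and> j < length [a, b, c, d] \<and>
          (j = Suc i mod length [a, b, c, d] \<or> i = Suc j mod length [a, b, c, d])}"
        unfolding len by (rule ends)
    qed (use dist in auto)
  qed
  moreover have "card (verts ?H) = 4" using dist by simp
  ultimately show ?thesis using ind unfolding chordal_def by (metis order_refl)
qed

lemma clique_card_le_coloring:
  assumes "proper_coloring H k c" "clique H K"
  shows "card K \<le> k"
proof -
  have "inj_on c K"
    using assms by (fastforce simp: inj_on_def proper_coloring_def clique_def)
  moreover have "c ` K \<subseteq> {..<k}"
    using assms by (auto simp: proper_coloring_def clique_def)
  ultimately show ?thesis by (metis card_inj_on_le card_lessThan finite_lessThan)
qed

lemma clique_number_attained:
  assumes "finite (verts H)"
  shows "\<exists>K. clique H K \<and> card K = clique_number H"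
proof -
  have "{card K | K. clique H K} \<subseteq> card ` Pow (verts H)" by (auto simp: clique_def)
  then have "finite {card K | K. clique H K}" by (rule finite_subset) (use assms in simp)
  moreover have "clique H {}" by (simp add: clique_def)
  ultimately have "clique_number H \<in> {card K | K. clique H K}"
    unfolding clique_number_def by (intro Max_in) auto
  then show ?thesis by force
qed

text \<open>
  A clique as large as the palette of a proper colouring certifies that both are optimal.
\<close>
lemma chromatic_eq_clique_numberI:
  assumes coloring: "proper_coloring H k c" and K: "clique H K" "card K = k"
  shows "chromatic_number H = clique_number H"
proof -
  have "chromatic_number H = k"
    unfolding chromatic_number_def
  proof (rule Least_equality)
    show "\<exists>c. proper_coloring H k c" using coloring by blast
    show "k \<le> k'" if "\<exists>c. proper_coloring H k' c" for k'
      using that clique_card_le_coloring K by blast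
  qed
  moreover have "clique_number H = k"
    unfolding clique_number_def
  proof (rule Max_eqI)
    show "finite {card K | K. clique H K}"
      by (rule finite_subset[of _ "{..k}"]) (use clique_card_le_coloring[OF coloring] in auto)
    show "y \<le> k" if "y \<in> {card K | K. clique H K}" for y
      using that clique_card_le_coloring[OF coloring] by auto
    show "k \<in> {card K | K. clique H K}" using K by blast
  qed
  ultimately show ?thesis by simp
qed

lemma chromatic_number_coloring:
  assumes "proper_coloring H k c"
  shows "\<exists>c. proper_coloring H (chromatic_number H) c"
  unfolding chromatic_number_def by (rule LeastI[of _ k]) (use assms in blast)

text \<open>
  A 5-cycle has no triangle, so its clique number is at most 2, and being odd it has no proper
  2-colouring.
\<close>
lemma not_perfect_if_induced_C5:
  assumes G: "pair_graph G"
    and V: "{a, b, c, d, e} \<subseteq> pverts G"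
    and arcs: "(a, b) \<in> parcs G" "(b, c) \<in> parcs G" "(c, d) \<in> parcs G" "(d, e) \<in> parcs G"
      "(e, a) \<in> parcs G"
    and non_arcs: "(a, c) \<notin> parcs G" "(b, d) \<notin> parcs G" "(c, e) \<notin> parcs G"
      "(d, a) \<notin> parcs G" "(e, b) \<notin> parcs G"
  shows "\<not> perfect (with_proj G)"
proof
  assume perf: "perfect (with_proj G)"
  interpret pair_graph G by fact
  define W where "W = {a, b, c, d, e}"
  then have W: "a \<in> W" "b \<in> W" "c \<in> W" "d \<in> W" "e \<in> W" "finite W" by simp_all
  let ?H = "with_proj G \<restriction> W"
  note ind = induced_subgraph_restrict_with_proj[OF G V, folded W_def]
  have symm: "(y, x) \<in> parcs G" if "(x, y) \<in> parcs G" for x y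
    using that pair_sym_arcs by (auto simp: symmetric_def sym_def)
  have irrefl: "(x, x) \<notin> parcs G" for x
    using pair_no_loops by (metis fst_conv snd_conv)
  have ends: "arcs_ends ?H = parcs G \<inter> W \<times> W"
    using induced_subgraph_with_projD(2)[OF ind] by simp
  \<comment> \<open>Some proper colouring must exist for the least number of colours to be attained.\<close>
  have "\<exists>c. proper_coloring ?H (card (verts ?H)) c"
  proof -
    obtain f where "inj_on f (verts ?H)" "f ` verts ?H = {..<card (verts ?H)}"
      using ex_bij_betw_finite_nat[of "verts ?H"] W by (auto simp: bij_betw_def lessThan_atLeast0)
    then have "proper_coloring ?H (card (verts ?H)) f"
      using irrefl unfolding proper_coloring_def ends inj_on_def by fastforce
    then show ?thesis by blast
  qed
  then obtain f where f: "proper_coloring ?H (chromatic_number ?H) f"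
    using chromatic_number_coloring by blast
  obtain K where K: "clique ?H K" "card K = clique_number ?H"
    using clique_number_attained[of ?H] W by auto
  have "card K \<le> 2"
  proof (rule ccontr)
    assume "\<not> card K \<le> 2"
    then obtain T where "T \<subseteq> K" "card T = 3" 
      by (metis obtain_subset_with_card_n not_less_eq_eq numeral_2_eq_2 numeral_3_eq_3)
    then obtain x y z where xyz: "{x, y, z} \<subseteq> K" "x \<noteq> y" "y \<noteq> z" "x \<noteq> z"
      by (auto simp: card_3_iff)
    have non: "(c, a) \<notin> parcs G" "(d, b) \<notin> parcs G" "(e, c) \<notin> parcs G"
      "(a, d) \<notin> parcs G" "(b, e) \<notin> parcs G" using non_arcs symm by blast+
    from xyz K(1) have "{x, y, z} \<subseteq> W" "(x, y) \<in> parcs G" "(y, z) \<in> parcs G" "(x, z) \<in> parcs G"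
      by (auto simp: clique_def ends)
    then show False using non non_arcs irrefl by (auto simp: W_def)
  qed
  moreover have "chromatic_number ?H = clique_number ?H"
    using perf ind by (auto simp: perfect_def)
  ultimately have "chromatic_number ?H \<le> 2" using K by simp
  with f have bd: "f v < 2" if "v \<in> W" for v
    using that by (fastforce simp: proper_coloring_def)
  have "f a \<noteq> f b" "f b \<noteq> f c" "f c \<noteq> f d" "f d \<noteq> f e" "f e \<noteq> f a"
    using f arcs W by (auto simp: proper_coloring_def ends)
  moreover have "f a < 2" "f b < 2" "f c < 2" "f d < 2" "f e < 2" using W bd by auto
  ultimately show False by linarith
qed

section \<open>Disjointness graphs of set-labelled vertices\<close>

definition disjointness_graph :: "'a set \<Rightarrow> ('a \<Rightarrow> 'b set) \<Rightarrow> 'a pair_pre_digraph" where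
  "disjointness_graph V A =
     \<lparr> pverts = V, parcs = {(x, y). x \<in> V \<and> y \<in> V \<and> A x \<inter> A y = {}} \<rparr>"

lemma pverts_disjointness_graph [simp]: "pverts (disjointness_graph V A) = V"
  by (simp add: disjointness_graph_def)

lemma parcs_disjointness_graph [simp]:
  "(x, y) \<in> parcs (disjointness_graph V A) \<longleftrightarrow> x \<in> V \<and> y \<in> V \<and> A x \<inter> A y = {}"
  by (simp add: disjointness_graph_def)

lemma pverts_graph_complement [simp]: "pverts (graph_complement G) = pverts G"
  by (simp add: graph_complement_def)

lemma parcs_graph_complement [simp]:
  "(x, y) \<in> parcs (graph_complement G) \<longleftrightarrow>
     x \<in> pverts G \<and> y \<in> pverts G \<and> x \<noteq> y \<and> (x, y) \<notin> parcs G"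
  by (simp add: graph_complement_def)

lemma distinct_list_in_set:
  assumes "n \<le> card S"
  shows "\<exists>xs. distinct xs \<and> set xs \<subseteq> S \<and> length xs = n"
proof -
  obtain T where T: "T \<subseteq> S" "card T = n" "finite T"
    using assms by (metis obtain_subset_with_card_n)
  then show ?thesis using finite_distinct_list[OF T(3)] distinct_card by metis
qed

text \<open>
  Here \<open>U\<close> stands for the set of atoms. Existence is assumed for labels of size at most two
  because the forbidden cycles below are built from these; \<open>U\<close> itself is excluded, as elements
  above all atoms are not zero-divisors. Different vertices may carry the same label, as do
  elements of \<open>P\<close> in the same class.
\<close>
locale set_labelling =
  fixes V :: "'a set" and A :: "'a \<Rightarrow> 'b set" and U :: "'b set"
  assumes finite_V: "finite V"
    and finite_U: "finite U"
    and label_nonempty: "x \<in> V \<Longrightarrow> A x \<noteq> {}"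
    and label_proper: "x \<in> V \<Longrightarrow> A x \<subset> U"
    and singleton_label: "\<lbrakk>p \<in> U; U \<noteq> {p}\<rbrakk> \<Longrightarrow> \<exists>x\<in>V. A x = {p}"
    and doubleton_label: "\<lbrakk>p \<in> U; r \<in> U; U \<noteq> {p, r}\<rbrakk> \<Longrightarrow> \<exists>x\<in>V. A x = {p, r}"
begin

abbreviation "\<Gamma> \<equiv> disjointness_graph V A"

lemma finite_label: "x \<in> V \<Longrightarrow> finite (A x)"
  using label_proper finite_U by (meson finite_subset psubset_imp_subset)

lemma card_label: "x \<in> V \<Longrightarrow> 0 < card (A x)" "x \<in> V \<Longrightarrow> card (A x) < card U"
  using label_nonempty finite_label psubset_card_mono[OF finite_U label_proper]
  by (auto simp: card_gt_0_iff)

lemma pair_graph_disjointness: "pair_graph \<Gamma>"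
proof -
  have "finite (parcs \<Gamma>)"
    by (rule finite_subset[of _ "V \<times> V"]) (auto simp: disjointness_graph_def finite_V)
  then show ?thesis
    using label_nonempty
    by unfold_locales (auto simp: disjointness_graph_def finite_V symmetric_def sym_def)
qed

lemma singleton_of_card_1: "x \<in> V \<Longrightarrow> card (A x) = 1 \<Longrightarrow> \<exists>p\<in>U. A x = {p}"
  using label_proper by (fastforce simp: card_1_singleton_iff)

lemma doubleton_label_of_card:
  assumes "3 \<le> card U" "p \<in> U" "r \<in> U"
  shows "\<exists>x\<in>V. A x = {p, r}"
proof -
  have "card {p, r} \<le> 2" by (simp add: card_insert_if)
  then have "U \<noteq> {p, r}" using assms(1) by auto
  then show ?thesis by (rule doubleton_label[OF assms(2,3)])
qed

text \<open>
  Along a chordless cycle with three atoms available, a label disjoint from the labels of two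
  different vertices is a singleton: a two-element label would leave only one atom, so both
  neighbours would carry the same singleton label and coincide. With two atoms all labels are
  singletons anyway, and the two classes cannot both contain two vertices of the cycle.
\<close>
lemma chordal_iff:
  assumes "U \<noteq> {}"
  shows "chordal \<Gamma> \<longleftrightarrow>
    card U = 1 \<or>
    (card U = 2 \<and> (\<exists>p\<in>U. card {x \<in> V. A x = {p}} = 1)) \<or>
    (card U = 3 \<and> (\<forall>p\<in>U. card {x \<in> V. A x = {p}} = 1))"
    (is "_ \<longleftrightarrow> ?R1 \<or> ?R2 \<or> ?R3")
proof
  assume R: "?R1 \<or> ?R2 \<or> ?R3"
  have uniq: "x = y" if "card {x \<in> V. A x = {p}} = 1" "x \<in> V" "y \<in> V" "A x = {p}" "A y = {p}" for x y p
  proof -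
    from that(1) obtain z where "{x \<in> V. A x = {p}} = {z}" by (auto simp: card_1_singleton_iff)
    moreover have "x \<in> {x \<in> V. A x = {p}}" "y \<in> {x \<in> V. A x = {p}}" using that by simp_all
    ultimately show ?thesis by simp
  qed
  show "chordal \<Gamma>"
  proof (rule chordal_if_no_induced_walk, goal_cases)
    case (1 w a b c d)
    then have V: "w \<in> V" "a \<in> V" "b \<in> V" "c \<in> V" "d \<in> V"
      and disj: "A w \<inter> A a = {}" "A a \<inter> A b = {}" "A b \<inter> A c = {}" "A c \<inter> A d = {}"
      and meet: "A w \<inter> A b \<noteq> {}" "A a \<inter> A c \<noteq> {}" "A b \<inter> A d \<noteq> {}"
      and neq: "w \<noteq> b" "a \<noteq> c" "b \<noteq> d"
      by auto
    have sing: "\<exists>p\<in>U. A x = {p}" if "x \<in> V" "card U = 2" for x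
      using singleton_of_card_1[OF that(1)] card_label[OF that(1)] that(2) by linarith
    consider (one) ?R1 | (two) ?R2 | (three) ?R3 using R by blast
    then show False
    proof cases
      case one
      then show False using card_label[OF \<open>a \<in> V\<close>] by simp
    next
      case two
      then obtain p where p: "p \<in> U" "card {x \<in> V. A x = {p}} = 1" and U: "card U = 2" by blast
      obtain s where s: "A a = {s}" "s \<in> U" using sing[OF V(2) U] by blast
      obtain t where t: "A b = {t}" "t \<in> U" using sing[OF V(3) U] by blast
      have "A c = {s}" "A d = {t}" using sing[OF V(4) U] sing[OF V(5) U] meet s t by auto
      moreover have "p = s \<or> p = t"
      proof -
        have "s \<noteq> t" using disj s t by auto
        then have "{s, t} = U" using s t U finite_U by (intro card_subset_eq) auto
        then show ?thesis using p by auto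
      qed
      ultimately show False using uniq[OF p(2)] V s t neq by blast
    next
      case three
      have narrow: "card (A y) = 1" if V': "x \<in> V" "y \<in> V" "z \<in> V" "x \<noteq> z"
        and d: "A x \<inter> A y = {}" "A y \<inter> A z = {}" for x y z
      proof (rule ccontr)
        assume "card (A y) \<noteq> 1"
        then have "card (A y) = 2" using card_label[OF V'(2)] three by linarith
        then have "card (U - A y) = 1"
          using three label_proper[OF V'(2)] finite_label[OF V'(2)] by (simp add: card_Diff_subset psubset_imp_subset)
        then obtain p where p: "U - A y = {p}" by (auto simp: card_1_singleton_iff)
        have "A x \<subseteq> {p}" "A z \<subseteq> {p}" using p d label_proper V' by blast+
        then have "A x = {p}" "A z = {p}" using label_nonempty V' by blast+
        moreover have "p \<in> U" using p by blast
        ultimately show False using uniq three V' by blast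
      qed
      obtain p where p: "p \<in> U" "A a = {p}"
        using singleton_of_card_1[OF V(2) narrow[OF V(1-3) neq(1) disj(1,2)]] by blast
      obtain r where r: "r \<in> U" "A c = {r}"
        using singleton_of_card_1[OF V(4) narrow[OF V(3-5) neq(3) disj(3,4)]] by blast
      show False using p r meet(2) uniq[of p a c] three V neq by auto
    qed
  qed
next
  assume chordal: "chordal \<Gamma>"
  show "?R1 \<or> ?R2 \<or> ?R3"
  proof (rule ccontr)
    assume nR: "\<not> (?R1 \<or> ?R2 \<or> ?R3)"
    have "card U \<noteq> 0" using assms finite_U by simp
    then have U2: "2 \<le> card U" using nR by linarith
    have U_ne: "U \<noteq> {p}" for p using U2 by (metis card.empty card_insert_le_m1 is_singletonI is_singleton_altdef numeral_le_one_iff semiring_norm(69))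
    have sing: "\<exists>x\<in>V. A x = {p}" if "p \<in> U" for p using singleton_label[OF that] U_ne by blast
    have twin: "\<exists>y\<in>V. A y = {p} \<and> y \<noteq> x" if x: "x \<in> V" "A x = {p}" and n1: "card {x \<in> V. A x = {p}} \<noteq> 1" for x p
    proof (rule ccontr)
      assume "\<not> ?thesis"
      then have "{y \<in> V. A y = {p}} = {x}" using x by blast
      with n1 show False by simp
    qed
    consider (two) "card U = 2" | (three) "card U = 3" | (four) "4 \<le> card U" using U2 by linarith
    then show False
    proof cases
      case two
      then obtain p r where pr: "U = {p, r}" "p \<noteq> r" by (auto simp: card_2_iff)
      have mem: "p \<in> U" "r \<in> U" using pr by auto
      obtain a where a: "a \<in> V" "A a = {p}" using sing[OF mem(1)] by blast
      obtain b where b: "b \<in> V" "A b = {r}" using sing[OF mem(2)] by blast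
      obtain a' where a': "a' \<in> V" "A a' = {p}" "a' \<noteq> a" using twin[OF a] nR two mem by blast
      obtain b' where b': "b' \<in> V" "A b' = {r}" "b' \<noteq> b" using twin[OF b] nR two mem by blast
      have "\<not> chordal \<Gamma>"
        by (rule not_chordal_if_induced_C4[OF pair_graph_disjointness, of a b a' b']) (use a b a' b' pr in auto)
      with chordal show False by simp
    next
      case three
      then obtain p where p: "p \<in> U" "card {x \<in> V. A x = {p}} \<noteq> 1" using nR by blast
      have "card (U - {p}) = 2" using three p finite_U by simp
      then obtain r s where rs: "U - {p} = {r, s}" "r \<noteq> s" by (auto simp: card_2_iff)
      have mem: "p \<in> U" "r \<in> U" using p rs by auto
      obtain a where a: "a \<in> V" "A a = {p}" using sing[OF mem(1)] by blast
      obtain b where b: "b \<in> V" "A b = {r}" using sing[OF mem(2)] by blast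
      obtain a' where a': "a' \<in> V" "A a' = {p}" "a' \<noteq> a" using twin[OF a p(2)] by blast
      obtain b' where b': "b' \<in> V" "A b' = {r, s}" using rs three doubleton_label_of_card[of r s] by auto
      have "\<not> chordal \<Gamma>"
        by (rule not_chordal_if_induced_C4[OF pair_graph_disjointness, of a b a' b']) (use a b a' b' rs in auto)
      with chordal show False by simp
    next
      case four
      then obtain xs where "distinct xs" "set xs \<subseteq> U" "length xs = 4"
      using distinct_list_in_set by metis
      then obtain p r s t where prst: "{p, r, s, t} \<subseteq> U" "distinct [p, r, s, t]"
        by (auto simp: length_Suc_conv numeral_eq_Suc)
      have U3: "3 \<le> card U" using four by simp
      have mem: "p \<in> U" "r \<in> U" using prst by auto
      obtain a where a: "a \<in> V" "A a = {p}" using sing[OF mem(1)] by blast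
      obtain b where b: "b \<in> V" "A b = {r}" using sing[OF mem(2)] by blast
      obtain a' where a': "a' \<in> V" "A a' = {p, s}" using prst U3 doubleton_label_of_card[of p s] by auto
      obtain b' where b': "b' \<in> V" "A b' = {r, t}" using prst U3 doubleton_label_of_card[of r t] by auto
      have "\<not> chordal \<Gamma>"
        by (rule not_chordal_if_induced_C4[OF pair_graph_disjointness, of a b a' b']) (use a b a' b' prst in auto)
      with chordal show False by simp
    qed
  qed
qed

text \<open>
  Five consecutive vertices \<open>w, a, b, c, d\<close> of a chordless cycle of meeting labels contain two
  disjoint labels, those of \<open>a\<close> and \<open>c\<close>, each bridging two disjoint labels.
\<close>
lemma chordal_complement_iff: "chordal (graph_complement \<Gamma>) \<longleftrightarrow> card U \<le> 3"
proof
  assume U: "card U \<le> 3"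
  show "chordal (graph_complement \<Gamma>)"
  proof (rule chordal_if_no_induced_walk, goal_cases)
    case (1 w a b c d)
    then have V: "w \<in> V" "a \<in> V" "b \<in> V" "c \<in> V" "d \<in> V"
      and meet: "A w \<inter> A a \<noteq> {}" "A a \<inter> A b \<noteq> {}" "A b \<inter> A c \<noteq> {}" "A c \<inter> A d \<noteq> {}"
      and disj: "A w \<inter> A b = {}" "A a \<inter> A c = {}" "A b \<inter> A d = {}"
      by auto
    have wide: "2 \<le> card (A y)" if y: "y \<in> V" "A x \<inter> A y \<noteq> {}" "A y \<inter> A z \<noteq> {}" "A x \<inter> A z = {}" for x y z
    proof -
      obtain p where p: "p \<in> A x \<inter> A y" using y(2) by blast
      obtain r where r: "r \<in> A y \<inter> A z" using y(3) by blast
      have "{p, r} \<subseteq> A y" "p \<noteq> r" using p r y(4) by auto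
      then show ?thesis using card_mono[OF finite_label[OF y(1)], of "{p, r}"] by simp
    qed
    have "card (A a \<union> A c) = card (A a) + card (A c)"
      using disj V by (intro card_Un_disjoint finite_label) auto
    moreover have "card (A a \<union> A c) \<le> card U"
      using V label_proper finite_U by (intro card_mono) auto
    moreover have "2 \<le> card (A a)" using wide[OF V(2) meet(1,2) disj(1)] .
    moreover have "2 \<le> card (A c)" using wide[OF V(4) meet(3,4) disj(3)] .
    ultimately show False using U by linarith
  qed
next
  assume chordal: "chordal (graph_complement \<Gamma>)"
  show "card U \<le> 3"
  proof (rule ccontr)
    assume "\<not> card U \<le> 3"
    then have large: "4 \<le> card U" by simp
    then obtain xs where "distinct xs" "set xs \<subseteq> U" "length xs = 4"
      using distinct_list_in_set by metis
    then obtain p r s t where prst: "{p, r, s, t} \<subseteq> U" "distinct [p, r, s, t]"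
      by (auto simp: length_Suc_conv numeral_eq_Suc)
    have U3: "3 \<le> card U" using large by simp
    obtain a where a: "a \<in> V" "A a = {p, r}" using prst U3 doubleton_label_of_card[of p r] by auto
    obtain b where b: "b \<in> V" "A b = {r, s}" using prst U3 doubleton_label_of_card[of r s] by auto
    obtain c where c: "c \<in> V" "A c = {s, t}" using prst U3 doubleton_label_of_card[of s t] by auto
    obtain d where d: "d \<in> V" "A d = {t, p}" using prst U3 doubleton_label_of_card[of t p] by auto
    have "a \<noteq> b" "b \<noteq> c" "c \<noteq> d" "d \<noteq> a" "a \<noteq> c" "b \<noteq> d"
      using a b c d prst by (auto simp: doubleton_eq_iff)
    then have "\<not> chordal (graph_complement \<Gamma>)"
      by (intro not_chordal_if_induced_C4[OF pair_graph_graph_complement[OF pair_graph_disjointness], of a b c d])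
         (use a b c d prst in auto)
    with chordal show False by simp
  qed
qed

text \<open>
  In the proof, \<open>T\<close> collects the atoms \<open>p\<close> whose singleton label \<open>{p}\<close> occurs in \<open>H\<close>, and \<open>R\<close>
  consists of the vertices whose label avoids \<open>T\<close>. All labels in \<open>R\<close> are disjoint from
  the singletons in \<open>T\<close>, so a clique in \<open>R\<close> extends by \<open>card T\<close> vertices, while vertices
  outside \<open>R\<close> cost no colours beyond the \<open>card T\<close> stars. This leaves the equality to be
  shown for \<open>R\<close>, whose labels have at least two of the at most four atoms.
\<close>
lemma chromatic_eq_clique_number:
  assumes U: "card U \<le> 4" and H: "induced_subgraph H \<Gamma>"
  shows "chromatic_number H = clique_number H"
proof -
  define W where "W = verts H"
  have WV: "W \<subseteq> V" using induced_subgraph_with_projD(1)[OF H] by (simp add: W_def)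
  have ends: "(x, y) \<in> arcs_ends H \<longleftrightarrow> x \<in> W \<and> y \<in> W \<and> A x \<inter> A y = {}" for x y
    using induced_subgraph_with_projD(2)[OF H] WV by (auto simp: W_def)
  define T where "T = {p. \<exists>x\<in>W. A x = {p}}"
  have TU: "T \<subseteq> U" using WV label_proper by (fastforce simp: T_def)
  then have finT: "finite T" using finite_U finite_subset by blast
  define R where "R = {x \<in> W. A x \<inter> T = {}}"
  have "\<forall>p\<in>T. \<exists>x. x \<in> W \<and> A x = {p}" by (auto simp: T_def)
  from bchoice[OF this] obtain g where g: "\<And>p. p \<in> T \<Longrightarrow> g p \<in> W \<and> A (g p) = {p}" by blast
  obtain f where f: "bij_betw f T {..<card T}"
    using ex_bij_betw_finite_nat[OF finT] by (auto simp: lessThan_atLeast0)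
  have f_less: "f p < card T" if "p \<in> T" for p using f that by (auto simp: bij_betw_def)
  have inj_g: "inj_on g T" using g by (metis inj_onI singleton_inject)
  have clique_T: "clique H (g ` T \<union> K)" "card (g ` T \<union> K) = card T + card K"
    if "finite K" "K \<subseteq> R" "\<And>x y. x \<in> K \<Longrightarrow> y \<in> K \<Longrightarrow> x \<noteq> y \<Longrightarrow> A x \<inter> A y = {}" for K
  proof -
    show "clique H (g ` T \<union> K)"
      using that g by (fastforce simp: clique_def ends R_def W_def[symmetric])
    have "g ` T \<inter> K = {}" using that g by (fastforce simp: R_def)
    then show "card (g ` T \<union> K) = card T + card K"
      using that finT inj_g by (simp add: card_Un_disjoint card_image)
  qed
  \<comment> \<open>Vertices outside \<open>R\<close> share a colour only if they share an atom of \<open>T\<close>.\<close>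
  define star where "star x = f (SOME p. p \<in> A x \<inter> T)" for x
  have star: "\<exists>p\<in>A x \<inter> T. star x = f p" if "x \<in> W - R" for x
  proof -
    have "\<exists>p. p \<in> A x \<inter> T" using that by (auto simp: R_def)
    then have "(SOME p. p \<in> A x \<inter> T) \<in> A x \<inter> T" by (rule someI_ex)
    then show ?thesis by (auto simp: star_def)
  qed
  have coloring: "proper_coloring H (card T + m) (\<lambda>x. if x \<in> R then card T + h x else star x)"
    if h: "\<And>x. x \<in> R \<Longrightarrow> h x < m" "\<And>x y. x \<in> R \<Longrightarrow> y \<in> R \<Longrightarrow> A x \<inter> A y = {} \<Longrightarrow> h x \<noteq> h y" for h m
  proof -
    have s_less: "star x < card T" if "x \<in> W - R" for x
      using star[OF that] f_less by fastforce
    have s_ne: "star x \<noteq> star y" if xy: "x \<in> W - R" "y \<in> W - R" "A x \<inter> A y = {}" for x y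
    proof -
      obtain p where p: "p \<in> A x \<inter> T" "star x = f p" using star[OF xy(1)] by blast
      obtain r where r: "r \<in> A y \<inter> T" "star y = f r" using star[OF xy(2)] by blast
      have "p \<noteq> r" using p r xy(3) by blast
      then show ?thesis using f p r by (auto simp: bij_betw_def inj_on_def)
    qed
    show ?thesis
      unfolding proper_coloring_def
    proof (intro conjI ballI, goal_cases)
      case (1 v)
      then show ?case using h(1)[of v] s_less[of v] by (auto simp: W_def)
    next
      case (2 e)
      then obtain x y where e: "e = (x, y)" "x \<in> W" "y \<in> W" "A x \<inter> A y = {}" using ends by (cases e) auto
      then show ?case using h(2)[of x y] s_less[of x] s_less[of y] s_ne[of x y] by auto
    qed
  qed
  have reduce: ?thesis
    if "finite K" "K \<subseteq> R" "\<And>x y. x \<in> K \<Longrightarrow> y \<in> K \<Longrightarrow> x \<noteq> y \<Longrightarrow> A x \<inter> A y = {}"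
      "\<And>x. x \<in> R \<Longrightarrow> h x < card K" "\<And>x y. x \<in> R \<Longrightarrow> y \<in> R \<Longrightarrow> A x \<inter> A y = {} \<Longrightarrow> h x \<noteq> h y" for K h
    by (rule chromatic_eq_clique_numberI[OF coloring clique_T]) (fact that)+
  consider (empty) "R = {}" | (meeting) x where "x \<in> R" "\<And>x y. x \<in> R \<Longrightarrow> y \<in> R \<Longrightarrow> A x \<inter> A y \<noteq> {}"
    | (disj) x y where "x \<in> R" "y \<in> R" "A x \<inter> A y = {}"
    by blast
  then show ?thesis
  proof cases
    case empty
    then show ?thesis by (intro reduce[of "{}" "\<lambda>_. 0"]) auto
  next
    case meeting
    then show ?thesis by (intro reduce[of "{x}" "\<lambda>_. 0"]) auto
  next
    case disj
    have xV: "x \<in> V" using disj WV by (auto simp: R_def)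
    then obtain u where u: "u \<in> A x" using label_nonempty by blast
    then have uU: "u \<in> U" using xV label_proper by blast
    define h where "h z = (if u \<in> A z then 0 else 1 :: nat)" for z
    \<comment> \<open>Two disjoint labels of size at least 2 that both avoid \<open>u\<close> would need five atoms.\<close>
    have h: "h z \<noteq> h z'" if z: "z \<in> R" "z' \<in> R" "A z \<inter> A z' = {}" for z z'
    proof
      assume "h z = h z'"
      then have u': "u \<notin> A z" "u \<notin> A z'" using z(3) by (auto simp: h_def split: if_splits)
      have wide: "2 \<le> card (A v)" if v: "v \<in> R" for v
      proof (rule ccontr)
        assume "\<not> 2 \<le> card (A v)"
        then have "card (A v) = 1" using card_label(1)[of v] v WV by (force simp: R_def)
        then obtain p where p: "A v = {p}" by (auto simp: card_1_singleton_iff)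
        then show False using v by (auto simp: R_def T_def)
      qed
      have zV: "z \<in> V" "z' \<in> V" using z WV by (auto simp: R_def)
      have "card (A z \<union> A z') = card (A z) + card (A z')"
        using z(3) zV by (intro card_Un_disjoint finite_label) auto
      moreover have "card (A z \<union> A z') < card U"
        using u' uU zV label_proper finite_U by (intro psubset_card_mono) auto
      ultimately show False using wide[OF z(1)] wide[OF z(2)] U by linarith
    qed
    have "x \<noteq> y" using disj u by auto
    then have "card {x, y} = 2" by simp
    then show ?thesis using disj h by (intro reduce[of "{x, y}" h]) (auto simp: h_def Int_commute)
  qed
qed

lemma perfect_iff: "perfect \<Gamma> \<longleftrightarrow> card U \<le> 4"
proof
  assume "card U \<le> 4"
  then show "perfect \<Gamma>" using chromatic_eq_clique_number by (auto simp: perfect_def)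
next
  assume perfect: "perfect \<Gamma>"
  show "card U \<le> 4"
  proof (rule ccontr)
    assume "\<not> card U \<le> 4"
    then have large: "5 \<le> card U" by simp
    then obtain xs where "distinct xs" "set xs \<subseteq> U" "length xs = 5"
      using distinct_list_in_set by metis
    then obtain p r s t v where prst: "{p, r, s, t, v} \<subseteq> U" "distinct [p, r, s, t, v]"
      by (auto simp: length_Suc_conv numeral_eq_Suc)
    have U3: "3 \<le> card U" using large by simp
    obtain a where a: "a \<in> V" "A a = {p, r}" using prst U3 doubleton_label_of_card[of p r] by auto
    obtain b where b: "b \<in> V" "A b = {s, t}" using prst U3 doubleton_label_of_card[of s t] by auto
    obtain c where c: "c \<in> V" "A c = {v, p}" using prst U3 doubleton_label_of_card[of v p] by auto
    obtain d where d: "d \<in> V" "A d = {r, s}" using prst U3 doubleton_label_of_card[of r s] by auto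
    obtain e where e: "e \<in> V" "A e = {t, v}" using prst U3 doubleton_label_of_card[of t v] by auto
    have "\<not> perfect \<Gamma>"
      by (rule not_perfect_if_induced_C5[OF pair_graph_disjointness, of a b c d e]) (use a b c d e prst in auto)
    with perfect show False by simp
  qed
qed

end

section \<open>Posets whose quotient is a Boolean lattice\<close>

definition atoms_below :: "('a, 'm) gorder_scheme \<Rightarrow> 'a \<Rightarrow> 'a set" where
  "atoms_below P x = {q \<in> poset_atoms P. q \<sqsubseteq>\<^bsub>P\<^esub> x}"

locale finite_poset_bottom = partial_order P + weak_partial_order_bottom P for P (structure) +
  assumes finite_carrier: "finite (carrier P)"
begin

lemma atoms_closed: "q \<in> poset_atoms P \<Longrightarrow> q \<in> carrier P"
  and atoms_nonzero: "q \<in> poset_atoms P \<Longrightarrow> q \<noteq> \<bottom>"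
  by (auto simp: poset_atoms_def)

lemma le_atomD: "q \<in> poset_atoms P \<Longrightarrow> x \<in> carrier P \<Longrightarrow> x \<sqsubseteq> q \<Longrightarrow> x \<noteq> \<bottom> \<Longrightarrow> x = q"
  by (auto simp: poset_atoms_def)

lemma atom_below_exists:
  assumes "x \<in> carrier P" "x \<noteq> \<bottom>"
  shows "\<exists>q\<in>poset_atoms P. q \<sqsubseteq> x"
  using assms
proof (induction "card {y \<in> carrier P. y \<sqsubseteq> x}" arbitrary: x rule: less_induct)
  case less
  show ?case
  proof (cases "x \<in> poset_atoms P")
    case True
    then show ?thesis using less.prems by auto
  next
    case False
    then obtain y where y: "y \<in> carrier P" "y \<noteq> \<bottom>" "y \<sqsubseteq> x" "y \<noteq> x"
      using less.prems by (auto simp: poset_atoms_def)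
    have below: "z \<sqsubseteq> x" if "z \<in> carrier P" "z \<sqsubseteq> y" for z
      by (rule le_trans[OF that(2) y(3)]) (use that y less.prems in auto)
    have "\<not> x \<sqsubseteq> y" using le_antisym[OF y(3)] y less.prems by blast
    then have "{z \<in> carrier P. z \<sqsubseteq> y} \<subset> {z \<in> carrier P. z \<sqsubseteq> x}"
      using below less.prems by blast
    then have "card {z \<in> carrier P. z \<sqsubseteq> y} < card {z \<in> carrier P. z \<sqsubseteq> x}"
      by (intro psubset_card_mono) (auto simp: finite_carrier)
    then obtain q where "q \<in> poset_atoms P" "q \<sqsubseteq> y" using less.hyps y by blast
    then show ?thesis using below atoms_closed by blast
  qed
qed

lemma atoms_below_bottom: "atoms_below P \<bottom> = {}"
  using le_antisym by (auto simp: atoms_below_def poset_atoms_def)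

lemma atoms_below_eq_empty_iff: "x \<in> carrier P \<Longrightarrow> atoms_below P x = {} \<longleftrightarrow> x = \<bottom>"
  using atom_below_exists atoms_below_bottom by (auto simp: atoms_below_def)

lemma atoms_below_atom: "q \<in> poset_atoms P \<Longrightarrow> atoms_below P q = {q}"
  using le_atomD atoms_closed atoms_nonzero by (auto simp: atoms_below_def)

lemma Lower_eq_bottom_iff:
  assumes "a \<in> carrier P" "b \<in> carrier P"
  shows "Lower P {a, b} = {\<bottom>} \<longleftrightarrow> atoms_below P a \<inter> atoms_below P b = {}"
proof
  assume L: "Lower P {a, b} = {\<bottom>}"
  have "q \<in> Lower P {a, b}" if "q \<in> atoms_below P a \<inter> atoms_below P b" for q
    using that atoms_closed by (auto simp: atoms_below_def Lower_def)
  then show "atoms_below P a \<inter> atoms_below P b = {}"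
    using L atoms_nonzero by (auto simp: atoms_below_def)
next
  assume D: "atoms_below P a \<inter> atoms_below P b = {}"
  have "x = \<bottom>" if x: "x \<in> Lower P {a, b}" for x
  proof (rule ccontr)
    assume "x \<noteq> \<bottom>"
    moreover have x': "x \<in> carrier P" "x \<sqsubseteq> a" "x \<sqsubseteq> b" using x assms by (auto simp: Lower_def)
    ultimately obtain q where q: "q \<in> poset_atoms P" "q \<sqsubseteq> x" using atom_below_exists by blast
    have "q \<sqsubseteq> a" "q \<sqsubseteq> b"
      using le_trans[OF q(2) x'(2)] le_trans[OF q(2) x'(3)] x'(1) assms atoms_closed[OF q(1)] by simp_all
    with q have "q \<in> atoms_below P a \<inter> atoms_below P b" by (simp add: atoms_below_def)
    with D show False by blast
  qed
  moreover have "\<bottom> \<in> Lower P {a, b}" using assms by (auto simp: Lower_def)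
  ultimately show "Lower P {a, b} = {\<bottom>}" by blast
qed

lemma perp_eq: "a \<in> carrier P \<Longrightarrow> perp P a = {b \<in> carrier P. atoms_below P a \<inter> atoms_below P b = {}}"
  by (simp add: perp_def Lower_eq_bottom_iff cong: conj_cong)

text \<open>
  An atom below \<open>a\<close> but not below \<open>b\<close> annihilates \<open>b\<close> and not \<open>a\<close>.
\<close>
lemma perp_subset_iff:
  assumes "a \<in> carrier P" "b \<in> carrier P"
  shows "perp P b \<subseteq> perp P a \<longleftrightarrow> atoms_below P a \<subseteq> atoms_below P b"
proof
  assume sub: "perp P b \<subseteq> perp P a"
  show "atoms_below P a \<subseteq> atoms_below P b"
  proof
    fix q assume q: "q \<in> atoms_below P a"
    then have qa: "q \<in> poset_atoms P" by (simp add: atoms_below_def)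
    then have "q \<notin> perp P a" using q assms by (auto simp: perp_eq atoms_below_atom)
    then have "q \<notin> perp P b" using sub by blast
    then show "q \<in> atoms_below P b"
      using qa assms atoms_closed by (auto simp: perp_eq atoms_below_atom)
  qed
qed (use assms in \<open>auto simp: perp_eq\<close>)

lemma zero_divisor_graph_eq:
  "zero_divisor_graph P = disjointness_graph
     {x \<in> carrier P. atoms_below P x \<noteq> {} \<and> atoms_below P x \<noteq> poset_atoms P} (atoms_below P)"
proof -
  have "zero_divisors P - {\<bottom>} =
      {x \<in> carrier P. atoms_below P x \<noteq> {} \<and> atoms_below P x \<noteq> poset_atoms P}" (is "?Z = ?V")
  proof (intro equalityI subsetI)
    fix x assume "x \<in> ?Z"
    then obtain b where x: "x \<in> carrier P" "x \<noteq> \<bottom>" and b: "b \<in> carrier P" "b \<noteq> \<bottom>"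
      and D: "atoms_below P x \<inter> atoms_below P b = {}"
      by (auto simp: zero_divisors_def simp flip: Lower_eq_bottom_iff)
    have "atoms_below P b \<noteq> {}" "atoms_below P b \<subseteq> poset_atoms P"
      using b atoms_below_eq_empty_iff by (auto simp: atoms_below_def)
    then show "x \<in> ?V" using x D atoms_below_eq_empty_iff by blast
  next
    fix x assume x: "x \<in> ?V"
    then obtain q where q: "q \<in> poset_atoms P" "q \<notin> atoms_below P x" by (auto simp: atoms_below_def)
    then have "Lower P {x, q} = {\<bottom>}"
      using x atoms_closed by (auto simp: Lower_eq_bottom_iff atoms_below_atom)
    moreover have "q \<in> carrier P - {\<bottom>}" using q atoms_closed atoms_nonzero by blast
    moreover have "x \<in> carrier P" "x \<noteq> \<bottom>" using x atoms_below_bottom by auto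
    ultimately show "x \<in> ?Z" unfolding zero_divisors_def by blast
  qed
  then show ?thesis
    by (simp add: zero_divisor_graph_def disjointness_graph_def Let_def Lower_eq_bottom_iff cong: conj_cong)
qed

end

locale boolean_quotient_poset = finite_poset_bottom +
  assumes boolean: "boolean_lattice (perp_quotient P)"
begin

text \<open>
  Take \<open>x\<close> in the join of the classes of \<open>p\<close> and \<open>r\<close>. Classes of different atoms meet in the
  class of \<open>\<bottom>\<close>, so by distributivity a third atom meets this join in the class of \<open>\<bottom>\<close>
  and cannot lie below \<open>x\<close>.
\<close>
lemma doubleton_atoms_below:
  assumes p: "p \<in> poset_atoms P" and r: "r \<in> poset_atoms P"
  shows "\<exists>x\<in>carrier P. atoms_below P x = {p, r}"
proof -
  interpret B: boolean_lattice "perp_quotient P" by (rule boolean)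
  define cls where "cls a = perp_rel P `` {a}" for a
  have carr: "carrier (perp_quotient P) = cls ` carrier P"
    by (auto simp: perp_quotient_def cls_def quotient_def)
  have le: "cls a \<sqsubseteq>\<^bsub>perp_quotient P\<^esub> cls b \<longleftrightarrow> atoms_below P a \<subseteq> atoms_below P b"
    if "a \<in> carrier P" "b \<in> carrier P" for a b
    unfolding cls_def using perp_quotient_le_iff[OF that] perp_subset_iff[OF that] by blast
  have in_carr: "cls a \<in> carrier (perp_quotient P)" if "a \<in> carrier P" for a
    using that carr by blast
  have meet_atoms: "cls a \<sqinter>\<^bsub>perp_quotient P\<^esub> cls b = cls \<bottom>"
    if "a \<in> poset_atoms P" "b \<in> poset_atoms P" "a \<noteq> b" for a b
  proof -
    have ab: "a \<in> carrier P" "b \<in> carrier P" using that atoms_closed by auto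
    then have "cls a \<sqinter>\<^bsub>perp_quotient P\<^esub> cls b \<in> carrier (perp_quotient P)"
      using in_carr B.meet_closed by blast
    then obtain m where m: "m \<in> carrier P" "cls a \<sqinter>\<^bsub>perp_quotient P\<^esub> cls b = cls m"
      using carr by blast
    have "atoms_below P m \<subseteq> atoms_below P a" "atoms_below P m \<subseteq> atoms_below P b"
      using B.meet_left[of "cls a" "cls b"] B.meet_right[of "cls a" "cls b"] ab m in_carr le by metis+
    then have "atoms_below P m = {}" using that by (auto simp: atoms_below_atom)
    then have "m = \<bottom>" using m atoms_below_eq_empty_iff by blast
    with m show ?thesis by simp
  qed
  have pr: "p \<in> carrier P" "r \<in> carrier P" using p r atoms_closed by auto
  have "cls p \<squnion>\<^bsub>perp_quotient P\<^esub> cls r \<in> carrier (perp_quotient P)"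
    using in_carr pr B.join_closed by blast
  then obtain x where x: "x \<in> carrier P" "cls p \<squnion>\<^bsub>perp_quotient P\<^esub> cls r = cls x"
    using carr by blast
  have "atoms_below P p \<subseteq> atoms_below P x" "atoms_below P r \<subseteq> atoms_below P x"
    using B.join_left[of "cls p" "cls r"] B.join_right[of "cls p" "cls r"] x pr in_carr le by metis+
  then have "{p, r} \<subseteq> atoms_below P x" using p r by (auto simp: atoms_below_atom)
  moreover have "s \<in> {p, r}" if s: "s \<in> atoms_below P x" for s
  proof (rule ccontr)
    assume ne: "s \<notin> {p, r}"
    have sa: "s \<in> poset_atoms P" using s by (simp add: atoms_below_def)
    have sc: "s \<in> carrier P" using sa atoms_closed by blast
    have bb: "cls \<bottom> \<squnion>\<^bsub>perp_quotient P\<^esub> cls \<bottom> \<sqsubseteq>\<^bsub>perp_quotient P\<^esub> cls \<bottom>"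
      using in_carr by (intro B.join_le B.le_refl) auto
    have "cls s \<sqinter>\<^bsub>perp_quotient P\<^esub> cls x = cls \<bottom> \<squnion>\<^bsub>perp_quotient P\<^esub> cls \<bottom>"
      using B.distributive[of "cls s" "cls p" "cls r"] in_carr sc pr x(2) meet_atoms sa p r ne by auto
    moreover have "cls s \<sqsubseteq>\<^bsub>perp_quotient P\<^esub> cls s \<sqinter>\<^bsub>perp_quotient P\<^esub> cls x"
    proof (rule B.meet_le)
      show "cls s \<sqsubseteq>\<^bsub>perp_quotient P\<^esub> cls x" using le sc x s sa by (auto simp: atoms_below_atom)
    qed (use in_carr sc x in auto)
    ultimately have "cls s \<sqsubseteq>\<^bsub>perp_quotient P\<^esub> cls \<bottom>"
      using bb in_carr sc B.le_trans by (metis B.join_closed bottom_closed)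
    then show False using le[OF sc bottom_closed] sa by (auto simp: atoms_below_atom atoms_below_bottom)
  qed
  ultimately show ?thesis using x by blast
qed

sublocale labelling: set_labelling
  "{x \<in> carrier P. atoms_below P x \<noteq> {} \<and> atoms_below P x \<noteq> poset_atoms P}"
  "atoms_below P" "poset_atoms P"
proof (unfold_locales, goal_cases)
  case 1
  show ?case using finite_carrier by simp
next
  case 2
  show ?case by (rule finite_subset[OF _ finite_carrier]) (auto simp: poset_atoms_def)
next
  case (3 x)
  then show ?case by simp
next
  case (4 x)
  then show ?case by (auto simp: atoms_below_def)
next
  case (5 p)
  then show ?case using atoms_closed[of p] atoms_below_atom[of p] by (intro bexI[of _ p]) auto
next
  case (6 p r)
  then obtain x where "x \<in> carrier P" "atoms_below P x = {p, r}"
    using doubleton_atoms_below by blast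
  with 6(3) show ?case by (intro bexI[of _ x]) auto
qed

end

theorem theorem1p1:
  fixes P :: "('a, 'm) gorder_scheme"
    and n :: nat
    and q :: "nat \<Rightarrow> 'a"
    and Q :: "nat \<Rightarrow> 'a set"
  assumes "partial_order P"
    and "finite (carrier P)"
    and "\<exists>z. least P z (carrier P)"
    and "carrier P \<noteq> {\<bottom>\<^bsub>P\<^esub>}"
    and "boolean_lattice (perp_quotient P)"
    and "bij_betw q {1..n} (poset_atoms P)"
    and "\<And>i. i \<in> {1..n} \<Longrightarrow>
           Q i = {x \<in> carrier P. q i \<sqsubseteq>\<^bsub>P\<^esub> x \<and> (\<forall>j\<in>{1..n}. j \<noteq> i \<longrightarrow> \<not> q j \<sqsubseteq>\<^bsub>P\<^esub> x)}"
  shows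
    "(chordal (zero_divisor_graph P) \<longleftrightarrow>
        card (poset_atoms P) = 1 \<or>
        (card (poset_atoms P) = 2 \<and> (\<exists>i\<in>{1, 2}. card (Q i) = 1)) \<or>
        (card (poset_atoms P) = 3 \<and> (\<forall>i\<in>{1, 2, 3}. card (Q i) = 1)))
     \<and> (chordal (graph_complement (zero_divisor_graph P)) \<longleftrightarrow> card (poset_atoms P) \<le> 3)
     \<and> (perfect (zero_divisor_graph P) \<longleftrightarrow> card (poset_atoms P) \<le> 4)"
proof -
  interpret partial_order P by fact
  interpret finite_poset_bottom P
    using assms(2,3) by unfold_locales
  interpret boolean_quotient_poset P
    by (intro boolean_quotient_poset.intro boolean_quotient_poset_axioms.intro
        finite_poset_bottom_axioms assms(5))
  let ?V = "{x \<in> carrier P. atoms_below P x \<noteq> {} \<and> atoms_below P x \<noteq> poset_atoms P}"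
  have n: "card (poset_atoms P) = n" using bij_betw_same_card[OF assms(6)] by simp
  have atoms: "poset_atoms P = q ` {1..n}" and inj: "inj_on q {1..n}"
    using assms(6) by (auto simp: bij_betw_def)
  have at_atoms: "(\<forall>p\<in>poset_atoms P. F p) \<longleftrightarrow> (\<forall>i\<in>{1..n}. F (q i))"
    "(\<exists>p\<in>poset_atoms P. F p) \<longleftrightarrow> (\<exists>i\<in>{1..n}. F (q i))" for F
    unfolding atoms by blast+
  have "poset_atoms P \<noteq> {}"
    using assms(4) bottom_closed atom_below_exists by blast
  note chordal = labelling.chordal_iff[OF this]
  have Q: "Q i = {x \<in> ?V. atoms_below P x = {q i}}" if i: "i \<in> {1..n}" and n2: "2 \<le> n" for i
  proof -
    have "poset_atoms P \<noteq> {q i}" using n n2 by auto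
    then have "{x \<in> ?V. atoms_below P x = {q i}} = {x \<in> carrier P. atoms_below P x = {q i}}" by auto
    also have "\<dots> = Q i"
    proof -
      have "atoms_below P x = {q i} \<longleftrightarrow> q i \<sqsubseteq>\<^bsub>P\<^esub> x \<and> (\<forall>j\<in>{1..n}. j \<noteq> i \<longrightarrow> \<not> q j \<sqsubseteq>\<^bsub>P\<^esub> x)" for x
      proof -
        have "atoms_below P x = q ` {j \<in> {1..n}. q j \<sqsubseteq>\<^bsub>P\<^esub> x}"
          by (auto simp: atoms_below_def atoms)
        moreover have "q ` {j \<in> {1..n}. q j \<sqsubseteq>\<^bsub>P\<^esub> x} = q ` {i} \<longleftrightarrow> {j \<in> {1..n}. q j \<sqsubseteq>\<^bsub>P\<^esub> x} = {i}"
          by (rule inj_on_image_eq_iff[OF inj]) (use i in auto)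
        moreover have "{j \<in> {1..n}. q j \<sqsubseteq>\<^bsub>P\<^esub> x} = {i} \<longleftrightarrow>
            q i \<sqsubseteq>\<^bsub>P\<^esub> x \<and> (\<forall>j\<in>{1..n}. j \<noteq> i \<longrightarrow> \<not> q j \<sqsubseteq>\<^bsub>P\<^esub> x)"
          using i by blast
        ultimately show ?thesis by simp
      qed
      then show ?thesis by (simp add: assms(7)[OF i])
    qed
    finally show ?thesis by simp
  qed
  have two: "(\<exists>p\<in>poset_atoms P. card {x \<in> ?V. atoms_below P x = {p}} = 1) \<longleftrightarrow>
      (\<exists>i\<in>{1, 2}. card (Q i) = 1)" if "n = 2"
  proof -
    have "(\<exists>p\<in>poset_atoms P. card {x \<in> ?V. atoms_below P x = {p}} = 1) \<longleftrightarrow>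
        (\<exists>i\<in>{1..n}. card {x \<in> ?V. atoms_below P x = {q i}} = 1)"
      by (rule at_atoms(2))
    also have "\<dots> \<longleftrightarrow> (\<exists>i\<in>{1..n}. card (Q i) = 1)"
      using Q that by (intro bex_cong) auto
    also have "{1..n} = {1, 2}" using that by auto
    finally show ?thesis .
  qed
  have three: "(\<forall>p\<in>poset_atoms P. card {x \<in> ?V. atoms_below P x = {p}} = 1) \<longleftrightarrow>
      (\<forall>i\<in>{1, 2, 3}. card (Q i) = 1)" if "n = 3"
  proof -
    have "(\<forall>p\<in>poset_atoms P. card {x \<in> ?V. atoms_below P x = {p}} = 1) \<longleftrightarrow>
        (\<forall>i\<in>{1..n}. card {x \<in> ?V. atoms_below P x = {q i}} = 1)"
      by (rule at_atoms(1))
    also have "\<dots> \<longleftrightarrow> (\<forall>i\<in>{1..n}. card (Q i) = 1)"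
      using Q that by (intro ball_cong) auto
    also have "{1..n} = {1, 2, 3}" using that by auto
    finally show ?thesis .
  qed
  show ?thesis
    using chordal two three labelling.chordal_complement_iff labelling.perfect_iff n
    unfolding zero_divisor_graph_eq by blast
qed

end
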